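(* Let $d\in\mathbb N$, $d\ge1$, $\mathsf Q=4d+2$, and let $\widetilde K_r$ be the kinetic kernel defined in the context. Let $1\le\theta\le\infty$ and let $\theta'$ be the Hölder conjugate exponent, $\frac1\theta+\frac1{\theta'}=1$. Then there is a constant $C>0$ (depending only on $d$ and the fixed function $\psi$) such that for all $r>0$ and $h\in\mathbb R^d$, $$\|\widetilde K_r\|_{L^\theta(\mathbb R^{1+2d})}\le C\,r^{1-\mathsf Q/\theta'},\qquad \|\nabla_y\widetilde K_r\|_{L^\theta(\mathbb R^{1+2d})}\le C\,r^{-2-\mathsf Q/\theta'},$$ and $$\|\Delta_x^h\widetilde K_r\|_{L^\theta(\mathbb R^{1+2d})}\le C\,r^{1-\mathsf Q/\theta'}\min\{1,\,|h|\,r^{-3}\}.$$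
   Context: Points of $\mathbb R^{1+2d}$ are written $(s,y,w)$ with $s\in\mathbb R$, $y,w\in\mathbb R^d$; $\nabla_y$ is differentiation in $y$. The difference operator acts on the spatial kernel variable $y$: $[\Delta_x^hJ](s,y,w)=J(s,y+h,w)-J(s,y,w)$. Fix a nonnegative $\psi\in C_c^\infty(\mathbb R^{1+2d})$, $\psi=\psi(m_0,m_1,m_2)$ with $m_0\in\mathbb R$, $m_1,m_2\in\mathbb R^d$, with $\int\psi=1$ and $\operatorname{supp}\psi\subset(-2,-1)\times B_1(0)\times B_1(0)$. For $r>0$ let $g_1(r)=r^3\sin\log r$ and $g_2(r)=r^3\cos\log r$. For $a\in\mathbb R\setminus\{0\}$, $r>0$, let $$\mathcal A_a(r)=\begin{pmatrix} g_1(r) & a\,g_2(r)\\ a^{-1}\frac{\dot g_1(r)}{2r} & \frac{\dot g_2(r)}{2r}\end{pmatrix},$$ where every scalar entry is understood as a multiple of the identity of $\mathbb R^d$, so $\mathcal A_a(r)$ acts on $\mathbb R^{2d}$ (and is invertible). For $r>0$ define $$\widetilde K_r(s,y,w)=-2^{d+1}s\,r^{-\mathsf Q-1}\,\psi\Bigl(\tfrac{s}{r^2},\ \mathcal A_{s/r^2}(r)^{-1}\tbinom yw\Bigr),$$ understood to be $0$ when $s/r^2\notin(-2,-1)$. *)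

theory Defs
  imports "HOL-Probability.Probability"
begin

text \<open>Points \<open>(s, y, w)\<close> of \<open>\<real>\<^bsup>1+2d\<^esup>\<close>, with \<open>d = CARD('d)\<close>.\<close>
type_synonym 'd point = "real \<times> (real ^ 'd) \<times> (real ^ 'd)"

primrec times_cont_diff :: "nat \<Rightarrow> ('a::real_normed_vector \<Rightarrow> real) \<Rightarrow> bool" where
  "times_cont_diff 0 f \<longleftrightarrow> continuous_on UNIV f"
| "times_cont_diff (Suc k) f \<longleftrightarrow>
     (\<forall>x. f differentiable at x) \<and>
     (\<forall>v. times_cont_diff k (\<lambda>x. frechet_derivative f (at x) v))"

definition smooth :: "('a::real_normed_vector \<Rightarrow> real) \<Rightarrow> bool" where
  "smooth f \<longleftrightarrow> (\<forall>k. times_cont_diff k f)"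

definition supp :: "('a::real_normed_vector \<Rightarrow> real) \<Rightarrow> 'a set" where
  "supp f = closure {x. f x \<noteq> 0}"

definition Cc_infty :: "('a::real_normed_vector \<Rightarrow> real) \<Rightarrow> bool" where
  "Cc_infty f \<longleftrightarrow> smooth f \<and> compact (supp f)"

text \<open>The \<open>L\<^sup>\<theta>\<close> norm with values in \<open>[0, \<infinity>]\<close>, so that a finite bound includes membership in
  \<open>L\<^sup>\<theta>\<close>. For non-measurable \<open>f\<close> it is \<open>\<infinity>\<close>, as \<open>esssup\<close> is, since
  the library's \<open>nn_integral\<close> is then only a lower integral.\<close>
definition Lnorm :: "ennreal \<Rightarrow> ('a::euclidean_space \<Rightarrow> 'b::euclidean_space) \<Rightarrow> ennreal" where
  "Lnorm \<theta> f =
     (if f \<notin> borel_measurable lborel then \<infinity>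
      else if \<theta> = \<infinity> then esssup lborel (\<lambda>x. ennreal (norm (f x)))
      else let I = (\<integral>\<^sup>+ x. ennreal (norm (f x) powr enn2real \<theta>) \<partial>lborel)
           in if I = \<infinity> then \<infinity> else ennreal (enn2real I powr (1 / enn2real \<theta>)))"

definition grad_y :: "('d::finite point \<Rightarrow> real) \<Rightarrow> 'd point \<Rightarrow> real ^ 'd" where
  "grad_y J = (\<lambda>(s, y, w). THE D. GDERIV (\<lambda>y'. J (s, y', w)) y :> D)"

definition diff_x :: "real ^ 'd \<Rightarrow> ('d::finite point \<Rightarrow> real) \<Rightarrow> 'd point \<Rightarrow> real" where
  "diff_x h J = (\<lambda>(s, y, w). J (s, y + h, w) - J (s, y, w))"

definition g1 :: "real \<Rightarrow> real" where
  "g1 r = r ^ 3 * sin (ln r)"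

definition g2 :: "real \<Rightarrow> real" where
  "g2 r = r ^ 3 * cos (ln r)"

text \<open>The \<open>2 \<times> 2\<close> matrix \<open>\<A>\<^sub>a(r)\<close>, each entry being a multiple of the identity of
  \<open>\<real>\<^sup>d\<close>, as a linear map on \<open>\<real>\<^sup>d \<times> \<real>\<^sup>d\<close>.\<close>
definition Amap :: "real \<Rightarrow> real \<Rightarrow> (real ^ 'd) \<times> (real ^ 'd) \<Rightarrow> (real ^ 'd::finite) \<times> (real ^ 'd)" where
  "Amap a r = (\<lambda>(p, q).
     (g1 r *\<^sub>R p + (a * g2 r) *\<^sub>R q,
      (inverse a * (deriv g1 r / (2 * r))) *\<^sub>R p + (deriv g2 r / (2 * r)) *\<^sub>R q))"

lemma deriv_g1: "r > 0 \<Longrightarrow> deriv g1 r = r\<^sup>2 * (3 * sin (ln r) + cos (ln r))"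
  unfolding g1_def [abs_def]
  by (rule DERIV_imp_deriv)
     (auto intro!: derivative_eq_intros simp: field_simps power2_eq_square power3_eq_cube)

lemma deriv_g2: "r > 0 \<Longrightarrow> deriv g2 r = r\<^sup>2 * (3 * cos (ln r) - sin (ln r))"
  unfolding g2_def [abs_def]
  by (rule DERIV_imp_deriv)
     (auto intro!: derivative_eq_intros simp: field_simps power2_eq_square power3_eq_cube)

lemma det_A:
  assumes "r > 0"
  shows "g1 r * (deriv g2 r / (2 * r)) - g2 r * (deriv g1 r / (2 * r)) = - (r ^ 4) / 2"
proof -
  have "g1 r * deriv g2 r - g2 r * deriv g1 r = - (r ^ 5) * ((sin (ln r))\<^sup>2 + (cos (ln r))\<^sup>2)"
    unfolding deriv_g1 [OF assms] deriv_g2 [OF assms] g1_def g2_def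
    by algebra
  then have "g1 r * deriv g2 r - g2 r * deriv g1 r = - (r ^ 5)"
    by simp
  moreover have "r ^ 5 = r * r ^ 4"
    by algebra
  ultimately show ?thesis
    using assms by (simp add: field_simps)
qed

text \<open>This justifies the use of \<^const>\<open>inv\<close> in the kernel below.\<close>
lemma bij_Amap:
  assumes "a \<noteq> 0" "r > 0"
  shows "bij (Amap a r :: (real ^ 'd) \<times> (real ^ 'd) \<Rightarrow> (real ^ 'd::finite) \<times> (real ^ 'd))"
proof -
  define \<alpha> \<beta> \<gamma> \<delta> where "\<alpha> = g1 r" and "\<beta> = a * g2 r"
    and "\<gamma> = inverse a * (deriv g1 r / (2 * r))" and "\<delta> = deriv g2 r / (2 * r)"
  define e where "e = \<alpha> * \<delta> - \<beta> * \<gamma>"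
  have "\<beta> * \<gamma> = (a * inverse a) * (g2 r * (deriv g1 r / (2 * r)))"
    unfolding \<beta>_def \<gamma>_def by (simp only: ac_simps)
  then have "e = - (r ^ 4) / 2"
    using det_A [OF assms(2)] assms(1) unfolding e_def \<alpha>_def \<delta>_def by simp
  then have e: "e \<noteq> 0"
    using assms(2) by simp
  let ?B = "\<lambda>(y, w). (inverse e *\<^sub>R (\<delta> *\<^sub>R y - \<beta> *\<^sub>R w), inverse e *\<^sub>R (\<alpha> *\<^sub>R w - \<gamma> *\<^sub>R y))"
  have A: "Amap a r = (\<lambda>(p, q). (\<alpha> *\<^sub>R p + \<beta> *\<^sub>R q, \<gamma> *\<^sub>R p + \<delta> *\<^sub>R q))"
    by (simp add: Amap_def \<alpha>_def \<beta>_def \<gamma>_def \<delta>_def)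
  have 1: "inverse e * (\<delta> * (\<alpha> * p + \<beta> * q) - \<beta> * (\<gamma> * p + \<delta> * q)) = p"
    "inverse e * (\<alpha> * (\<gamma> * p + \<delta> * q) - \<gamma> * (\<alpha> * p + \<beta> * q)) = q"
    "\<alpha> * (inverse e * (\<delta> * p - \<beta> * q)) + \<beta> * (inverse e * (\<alpha> * q - \<gamma> * p)) = p"
    "\<gamma> * (inverse e * (\<delta> * p - \<beta> * q)) + \<delta> * (inverse e * (\<alpha> * q - \<gamma> * p)) = q"
    for p q
    using e by (simp_all add: field_simps) (simp_all add: e_def algebra_simps)
  show ?thesis
    unfolding A by (rule o_bij [where g = ?B]) (auto simp: fun_eq_iff vec_eq_iff 1 mult.assoc)
qed

definition hom_dim :: "nat \<Rightarrow> nat" where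
  "hom_dim d = 4 * d + 2"

definition kin_kernel :: "('d::finite point \<Rightarrow> real) \<Rightarrow> real \<Rightarrow> 'd point \<Rightarrow> real" where
  "kin_kernel \<psi> r = (\<lambda>(s, y, w).
     if s / r\<^sup>2 \<in> {-2<..<-1}
     then - (2 ^ (CARD('d) + 1)) * s * r powr (- real (hom_dim CARD('d)) - 1)
            * \<psi> (s / r\<^sup>2, inv (Amap (s / r\<^sup>2) r) (y, w))
     else 0)"

end

theory Submission
  imports Defs
begin

text \<open>
  All three estimates are instances of one observation: a function that is bounded by \<open>N\<close> and
  vanishes off a set of measure \<open>c r\<^sup>Q\<close> has \<open>L\<^sup>\<theta>\<close> norm at most
  \<open>N (c r\<^sup>Q)\<^bsup>1/\<theta>\<^esup> \<le> N c r\<^sup>Q r\<^bsup>-Q/\<theta>'\<^esup>\<close> when \<open>c \<ge> 1\<close>, so only sup bounds and supports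
  have to be found (\<open>Lnorm_le_of_bounded_support\<close>).

  On the support of the kernel \<open>a = s/r\<^sup>2\<close> lies in \<open>(-2,-1)\<close>, so the rows of \<open>\<A>\<^sub>a(r)\<close> have size
  \<open>r\<^sup>3\<close> and \<open>r\<close>. Hence \<open>\<A>\<^sub>a(r)\<close> maps the product of unit balls into
  \<open>{|y| \<le> 3 r\<^sup>3, |w| \<le> 4 r}\<close>, and the kernel lives in a box of measure comparable to
  \<open>r\<^sup>2 r\<^bsup>3d\<^esup> r\<^sup>d = r\<^sup>Q\<close> (\<open>in_kinetic_boxI\<close>, \<open>emeasure_kinetic_box\<close>).
  The prefactor has size \<open>r\<^sup>2 r\<^bsup>-Q-1\<^esup>\<close>, which is the sup bound \<open>r\<^bsup>1-Q\<^esup>\<close>.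

  The scalar determinant of \<open>\<A>\<^sub>a(r)\<close> is \<open>-r\<^sup>4/2\<close>, and the entries of the adjugate that multiply \<open>y\<close>
  come from the second row, hence have size \<open>r\<close>. So a \<open>y\<close>-derivative costs a factor
  \<open>r/r\<^sup>4 = r\<^bsup>-3\<^esup>\<close> (\<open>norm_kernel_grad_le\<close>). Finally the increment is bounded both by twice
  the sup of the kernel and, through the mean value inequality, by \<open>|h|\<close> times the sup of the gradient,
  and it lives on the union of two translates of the box.
\<close>

section \<open>\<open>L\<^sup>\<theta>\<close> norms of bounded functions with small support\<close>

text \<open>Both reciprocals are at most \<open>1\<close>, hence finite, so the relation passes from \<open>ennreal\<close> to the reals
  even when one of the exponents is \<open>\<infinity>\<close>.\<close>
lemma conjugate_exponent_real:
  fixes \<theta> \<theta>' :: ennreal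
  assumes "1 \<le> \<theta>" "1 / \<theta> + 1 / \<theta>' = 1"
  shows "enn2real (1 / \<theta>') = 1 - enn2real (1 / \<theta>)"
proof -
  have "1 / \<theta> \<le> 1" "1 / \<theta>' \<le> 1"
    using assms(2) by (metis le_iff_add, metis le_iff_add add.commute)
  then have "1 / \<theta> < \<top>" "1 / \<theta>' < \<top>"
    using ennreal_one_less_top le_less_trans by blast+
  then have "enn2real (1 / \<theta> + 1 / \<theta>') = enn2real (1 / \<theta>) + enn2real (1 / \<theta>')"
    by (rule enn2real_plus)
  then show ?thesis
    using assms(2) by simp
qed

text \<open>For finite \<open>\<theta>\<close> integrate \<open>|f|\<^sup>\<theta> \<le> N\<^sup>\<theta> 1\<^sub>S\<close>. The condition \<open>c \<ge> 1\<close> allows \<open>c\<^bsup>1/\<theta>\<^esup>\<close> to be replaced by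
  \<open>c\<close>, which makes the constant independent of \<open>\<theta>\<close>.\<close>
lemma Lnorm_le_of_bounded_support:
  fixes f :: "'a::euclidean_space \<Rightarrow> 'b::euclidean_space" and \<theta> \<theta>' :: ennreal
  assumes f: "f \<in> borel_measurable borel"
    and S: "S \<in> sets borel" "emeasure lborel S \<le> ennreal (c * r powr Q)"
    and bound: "\<And>x. norm (f x) \<le> N" and zero: "\<And>x. x \<notin> S \<Longrightarrow> f x = 0"
    and "c \<ge> 1" "N \<ge> 0" "r > 0"
    and \<theta>: "1 \<le> \<theta>" "1 / \<theta> + 1 / \<theta>' = 1"
  shows "Lnorm \<theta> f \<le> ennreal (N * c * r powr (Q - Q * enn2real (1 / \<theta>')))"
proof (cases "\<theta> = \<infinity>")
  case True
  have "enn2real (1 / \<theta>') = 1"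
    using conjugate_exponent_real [OF \<theta>] True by simp
  moreover have "Lnorm \<theta> f \<le> ennreal N"
    using f True bound by (auto simp: Lnorm_def intro!: esssup_I ennreal_leI)
  moreover have "N \<le> N * c"
    using assms by (simp add: mult_le_cancel_left1)
  ultimately show ?thesis
    using \<open>r > 0\<close> by (auto intro: order.trans ennreal_leI)
next
  case False
  define t where "t = enn2real \<theta>"
  have \<theta>_eq: "\<theta> = ennreal t"
    using False by (simp add: t_def less_top)
  have t: "t \<ge> 1"
    using enn2real_mono [OF \<theta>(1)] False by (simp add: t_def less_top)
  have "1 / \<theta> = ennreal (1 / t)"
    using t divide_ennreal [of 1 t] by (simp add: \<theta>_eq)
  then have \<theta>': "enn2real (1 / \<theta>') = 1 - 1 / t"
    using conjugate_exponent_real [OF \<theta>] t by simp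
  define I where "I = (\<integral>\<^sup>+ x. ennreal (norm (f x) powr t) \<partial>lborel)"
  have "I \<le> (\<integral>\<^sup>+ x. ennreal (N powr t) * indicator S x \<partial>lborel)"
    unfolding I_def using bound zero t
    by (intro nn_integral_mono) (auto simp: indicator_def intro!: ennreal_leI powr_mono2)
  also have "\<dots> = ennreal (N powr t) * emeasure lborel S"
    using S(1) by (subst nn_integral_cmult_indicator) auto
  also have "\<dots> \<le> ennreal (N powr t) * ennreal (c * r powr Q)"
    using S(2) by (intro mult_left_mono) auto
  also have "\<dots> = ennreal (N powr t * (c * r powr Q))"
    using assms by (simp add: ennreal_mult)
  finally have I: "I \<le> ennreal (N powr t * (c * r powr Q))" .
  then have fin: "I \<noteq> \<infinity>"
    by (auto simp: top_unique)
  have "enn2real I \<le> N powr t * (c * r powr Q)"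
    using I assms by (metis enn2real_leI mult_nonneg_nonneg order.trans powr_ge_zero zero_le_one)
  then have "enn2real I powr (1 / t) \<le> (N powr t * (c * r powr Q)) powr (1 / t)"
    using t by (intro powr_mono2) auto
  also have "\<dots> = N * c powr (1 / t) * r powr (Q / t)"
    using assms t by (simp add: powr_mult powr_powr)
  also have "\<dots> \<le> N * c * r powr (Q / t)"
    using assms t powr_mono [of "1 / t" 1 c] by (intro mult_right_mono mult_left_mono) auto
  also have "Q / t = Q - Q * enn2real (1 / \<theta>')"
    unfolding \<theta>' by (simp add: algebra_simps)
  finally show ?thesis
    using f False fin by (auto simp: Lnorm_def Let_def I_def t_def intro: ennreal_leI)
qed

section \<open>Partial gradients of test functions\<close>

text \<open>The gradient of \<open>f\<close> pulled back along a linear map \<open>\<iota>\<close>, that is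
  \<open>\<iota>\<^sup>* \<nabla>f\<close>; for a coordinate inclusion \<open>\<iota>\<close> it is a partial gradient.\<close>
definition pull_grad ::
  "('b::euclidean_space \<Rightarrow> 'a::euclidean_space) \<Rightarrow> ('a \<Rightarrow> real) \<Rightarrow> 'a \<Rightarrow> 'b" where
  "pull_grad \<iota> f x = (\<Sum>b\<in>Basis. frechet_derivative f (at x) (\<iota> b) *\<^sub>R b)"

lemma smooth_has_derivative:
  assumes "smooth f"
  shows "(f has_derivative frechet_derivative f (at x)) (at x)"
proof -
  have "times_cont_diff (Suc 0) f"
    using assms unfolding smooth_def by blast
  then show ?thesis
    by (simp add: frechet_derivative_works)
qed

lemma smooth_continuous_on: "smooth f \<Longrightarrow> continuous_on UNIV f"
  unfolding smooth_def using times_cont_diff.simps(1) by blast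

lemma frechet_derivative_eq_inner_pull_grad:
  assumes "smooth f" "linear \<iota>"
  shows "frechet_derivative f (at x) (\<iota> v) = v \<bullet> pull_grad \<iota> f x"
proof -
  let ?L = "\<lambda>v. frechet_derivative f (at x) (\<iota> v)"
  have "linear (frechet_derivative f (at x))"
    using smooth_has_derivative [OF assms(1)] has_derivative_linear by blast
  then have lin: "linear ?L"
    using linear_compose [OF assms(2)] by (simp add: o_def)
  have "?L v = ?L (\<Sum>b\<in>Basis. (v \<bullet> b) *\<^sub>R b)"
    by (simp add: euclidean_representation)
  also have "\<dots> = (\<Sum>b\<in>Basis. (v \<bullet> b) * ?L b)"
    by (simp add: linear_sum [OF lin] linear_cmul [OF lin])
  also have "\<dots> = v \<bullet> pull_grad \<iota> f x"
    by (simp add: pull_grad_def inner_sum_right mult.commute)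
  finally show ?thesis .
qed

lemma continuous_on_pull_grad:
  assumes "smooth f"
  shows "continuous_on UNIV (pull_grad \<iota> f)"
proof -
  have "times_cont_diff (Suc 0) f"
    using assms unfolding smooth_def by blast
  then have "continuous_on UNIV (\<lambda>x. frechet_derivative f (at x) v)" for v
    by simp
  then show ?thesis
    unfolding pull_grad_def [abs_def] by (intro continuous_intros)
qed

lemma not_in_supp: "x \<notin> supp f \<Longrightarrow> f x = 0"
  unfolding supp_def using closure_subset [of "{x. f x \<noteq> 0}"] by blast

lemma pull_grad_not_in_supp:
  assumes "x \<notin> supp f"
  shows "pull_grad \<iota> f x = 0"
proof -
  have "((\<lambda>_. 0) has_derivative (\<lambda>_. 0)) (at x)"
    by simp
  then have "(f has_derivative (\<lambda>_. 0)) (at x)"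
    by (rule has_derivative_transform_within_open [where s = "- supp f"])
      (use assms not_in_supp in \<open>auto simp: supp_def\<close>)
  then have "frechet_derivative f (at x) = (\<lambda>_. 0)"
    by (metis frechet_derivative_at)
  then show ?thesis
    by (simp add: pull_grad_def)
qed

lemma bounded_of_compact_support:
  fixes f :: "'a::topological_space \<Rightarrow> 'b::real_normed_vector"
  assumes "continuous_on UNIV f" "compact K" "\<And>x. x \<notin> K \<Longrightarrow> f x = 0"
  obtains M where "M \<ge> 0" "\<And>x. norm (f x) \<le> M"
proof -
  have "bounded (f ` K)"
    using assms by (meson compact_continuous_image compact_imp_bounded continuous_on_subset subset_UNIV)
  then obtain M where "\<forall>x\<in>K. norm (f x) \<le> M"
    by (auto simp: bounded_iff)
  then have "norm (f x) \<le> max M 0" for x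
    using assms(3) by (cases "x \<in> K") (auto simp: le_max_iff_disj)
  then show thesis
    using that [of "max M 0"] by simp
qed

section \<open>The kernel in explicit form\<close>

definition kernel_amp :: "nat \<Rightarrow> real \<Rightarrow> real \<Rightarrow> real" where
  "kernel_amp d r s =
     (if s / r\<^sup>2 \<in> {-2<..<-1} then - (2 ^ (d + 1)) * s * r powr (- real (hom_dim d) - 1) else 0)"

text \<open>Cramer's rule for the argument of \<open>\<psi>\<close>: the scalar determinant of the matrix is \<open>-r\<^sup>4/2\<close>.\<close>
definition kernel_arg :: "real \<Rightarrow> 'd::finite point \<Rightarrow> 'd point" where
  "kernel_arg r = (\<lambda>(s, y, w). (s / r\<^sup>2,
     (- 2 / r ^ 4) *\<^sub>R ((deriv g2 r / (2 * r)) *\<^sub>R y - (s / r\<^sup>2 * g2 r) *\<^sub>R w),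
     (- 2 / r ^ 4) *\<^sub>R (g1 r *\<^sub>R w - (inverse (s / r\<^sup>2) * (deriv g1 r / (2 * r))) *\<^sub>R y)))"

lemma inv_Amap:
  fixes y w :: "real ^ 'd::finite"
  assumes "s \<noteq> 0" "r > 0"
  shows "(s / r\<^sup>2, inv (Amap (s / r\<^sup>2) r) (y, w)) = kernel_arg r (s, y, w)"
proof -
  define a where "a = s / r\<^sup>2"
  define \<gamma> \<delta> where "\<gamma> = deriv g1 r / (2 * r)" and "\<delta> = deriv g2 r / (2 * r)"
  have a: "a \<noteq> 0"
    using assms by (simp add: a_def)
  have det: "g1 r * \<delta> - g2 r * \<gamma> = - (r ^ 4) / 2"
    using det_A [OF assms(2)] by (simp add: \<gamma>_def \<delta>_def)
  have ainv: "a * inverse a = 1"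
    using a by simp
  define u where "u = - 2 / r ^ 4"
  have u: "u * (g1 r * \<delta> - g2 r * \<gamma>) = 1"
    using det assms(2) by (simp add: u_def)
  have row1: "g1 r * (u * (\<delta> * p - a * g2 r * q))
      + a * g2 r * (u * (g1 r * q - inverse a * \<gamma> * p)) = p"
    and row2: "inverse a * \<gamma> * (u * (\<delta> * p - a * g2 r * q))
      + \<delta> * (u * (g1 r * q - inverse a * \<gamma> * p)) = q" for p q
    using u ainv by algebra+
  have arg: "kernel_arg r (s, y, w) =
      (a, u *\<^sub>R (\<delta> *\<^sub>R y - (a * g2 r) *\<^sub>R w), u *\<^sub>R (g1 r *\<^sub>R w - (inverse a * \<gamma>) *\<^sub>R y))"
    by (simp only: kernel_arg_def prod.case a_def u_def \<gamma>_def \<delta>_def)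
  have A: "Amap a r =
      (\<lambda>(p, q). (g1 r *\<^sub>R p + (a * g2 r) *\<^sub>R q, (inverse a * \<gamma>) *\<^sub>R p + \<delta> *\<^sub>R q))"
    by (simp only: Amap_def \<gamma>_def \<delta>_def)
  have "Amap a r (snd (kernel_arg r (s, y, w))) = (y, w)"
    unfolding A arg
    by (simp only: prod.case snd_conv prod.inject vec_eq_iff vector_add_component
        vector_minus_component vector_scaleR_component real_scaleR_def row1 row2 simp_thms)
  then have "inv (Amap a r) (y, w) = snd (kernel_arg r (s, y, w))"
    using bij_Amap [OF a assms(2)] by (intro inv_f_eq) (auto simp: bij_def)
  then show ?thesis
    by (simp add: kernel_arg_def a_def)
qed

lemma kernel_amp_nonzero:
  assumes "kernel_amp d r s \<noteq> 0" "r > 0"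
  shows "s / r\<^sup>2 \<in> {-2<..<-1}" "s \<in> {- 2 * r\<^sup>2 .. - r\<^sup>2}" "s \<noteq> 0"
  using assms by (auto simp: kernel_amp_def field_simps split: if_splits)

lemma kin_kernel_eq:
  fixes \<psi> :: "'d::finite point \<Rightarrow> real"
  assumes "r > 0"
  shows "kin_kernel \<psi> r x = kernel_amp CARD('d) r (fst x) * \<psi> (kernel_arg r x)"
proof (cases x)
  case (fields s y w)
  show ?thesis
  proof (cases "s = 0")
    \<comment> \<open>The matrix degenerates here, but both sides vanish since \<open>0\<close> lies outside \<open>(-2,-1)\<close>.\<close>
    case True
    then show ?thesis
      by (simp add: fields kin_kernel_def kernel_amp_def)
  next
    case False
    then show ?thesis
      by (simp add: fields kin_kernel_def kernel_amp_def inv_Amap [OF False assms])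
  qed
qed

lemma abs_kernel_amp_le:
  assumes "r > 0"
  shows "\<bar>kernel_amp d r s\<bar> \<le> 2 ^ (d + 2) * r powr (1 - real (hom_dim d))"
proof (cases "kernel_amp d r s = 0")
  case True
  then show ?thesis by simp
next
  case False
  let ?q = "r powr (- real (hom_dim d) - 1)"
  have "\<bar>s\<bar> \<le> 2 * r\<^sup>2"
    using kernel_amp_nonzero [OF False assms] by auto
  then have "2 ^ (d + 1) * \<bar>s\<bar> * ?q \<le> 2 ^ (d + 1) * (2 * r\<^sup>2) * ?q"
    by (intro mult_right_mono mult_left_mono) auto
  also have "\<dots> = 2 ^ (d + 2) * (r powr 2 * ?q)"
    using assms by simp
  also have "r powr 2 * ?q = r powr (1 - real (hom_dim d))"
    by (simp flip: powr_add)
  finally show ?thesis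
    using False by (auto simp: kernel_amp_def abs_mult)
qed

text \<open>The derivatives of \<open>g1\<close> and \<open>g2\<close> are \<open>r\<^sup>2\<close> times \<open>3 sin + cos\<close> and \<open>3 cos - sin\<close>, which are at most
  \<open>4\<close> in size.\<close>
lemma abs_matrix_entries_le:
  assumes "r > 0"
  shows "\<bar>g1 r\<bar> \<le> r ^ 3" "\<bar>g2 r\<bar> \<le> r ^ 3"
    "\<bar>deriv g1 r / (2 * r)\<bar> \<le> 2 * r" "\<bar>deriv g2 r / (2 * r)\<bar> \<le> 2 * r"
proof -
  let ?s = "sin (ln r)" and ?c = "cos (ln r)"
  have sc: "\<bar>?s\<bar> \<le> 1" "\<bar>?c\<bar> \<le> 1"
    by simp_all
  show "\<bar>g1 r\<bar> \<le> r ^ 3" "\<bar>g2 r\<bar> \<le> r ^ 3"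
    using assms sc by (simp_all add: g1_def g2_def abs_mult mult_left_le)
  have *: "\<bar>r\<^sup>2 * u / (2 * r)\<bar> \<le> 2 * r" if "\<bar>u\<bar> \<le> 4" for u
  proof -
    have "\<bar>r\<^sup>2 * u / (2 * r)\<bar> = r / 2 * \<bar>u\<bar>"
      using assms by (simp add: abs_mult power2_eq_square)
    also have "\<dots> \<le> r / 2 * 4"
      using assms that by (intro mult_left_mono) auto
    finally show ?thesis by simp
  qed
  have "\<bar>3 * ?s + ?c\<bar> \<le> 4" "\<bar>3 * ?c - ?s\<bar> \<le> 4"
    using sc by linarith+
  then show "\<bar>deriv g1 r / (2 * r)\<bar> \<le> 2 * r" "\<bar>deriv g2 r / (2 * r)\<bar> \<le> 2 * r"
    using * deriv_g1 [OF assms] deriv_g2 [OF assms] by simp_all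
qed

lemma abs_inverse_time_le:
  assumes "a \<in> {-2<..<-1::real}"
  shows "\<bar>inverse a\<bar> \<le> 1"
proof -
  have "1 \<le> \<bar>a\<bar>"
    using assms by auto
  then have "inverse \<bar>a\<bar> \<le> inverse 1"
    by (intro le_imp_inverse_le) auto
  then show ?thesis
    by simp
qed

lemma abs_lower_left_entry_le:
  assumes "a \<in> {-2<..<-1::real}" "r > 0"
  shows "\<bar>inverse a * (deriv g1 r / (2 * r))\<bar> \<le> 2 * r"
proof -
  have "\<bar>inverse a\<bar> * \<bar>deriv g1 r / (2 * r)\<bar> \<le> 1 * (2 * r)"
    by (rule mult_mono [OF abs_inverse_time_le [OF assms(1)] abs_matrix_entries_le(3) [OF assms(2)]])
      simp_all
  then show ?thesis
    by (simp only: abs_mult mult_1_left)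
qed

section \<open>The support box and its measure\<close>

definition kinetic_box :: "real \<Rightarrow> 'd::finite point set" where
  "kinetic_box r = {- 2 * r\<^sup>2 .. - r\<^sup>2} \<times> cball 0 (3 * r ^ 3) \<times> cball 0 (4 * r)"

text \<open>The radii \<open>3 r\<^sup>3\<close> and \<open>4 r\<close> are the row sums of the entry bounds for \<open>|a| \<in> (1,2)\<close>.\<close>
lemma in_kinetic_boxI:
  fixes x :: "'d::finite point"
  assumes "r > 0" "kernel_amp d r (fst x) \<noteq> 0"
    and "kernel_arg r x \<in> {-2<..<-1} \<times> ball 0 1 \<times> ball 0 1"
  shows "x \<in> kinetic_box r"
proof (cases x)
  case (fields s y w)
  define a where "a = s / r\<^sup>2"
  have a: "a \<in> {-2<..<-1}" and s: "s \<in> {- 2 * r\<^sup>2 .. - r\<^sup>2}" "s \<noteq> 0"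
    using kernel_amp_nonzero assms(1,2) unfolding fields a_def by fastforce+
  obtain p q where pq: "inv (Amap a r) (y, w) = (p, q)"
    by fastforce
  have "norm p \<le> 1" "norm q \<le> 1"
    using assms(3) pq unfolding fields inv_Amap [OF s(2) assms(1), symmetric] by (auto simp: a_def)
  have "a \<noteq> 0"
    using a by auto
  then have "Amap a r (p, q) = (y, w)"
    using bij_Amap [OF _ assms(1)] by (metis bij_inv_eq_iff pq)
  then have y: "y = g1 r *\<^sub>R p + (a * g2 r) *\<^sub>R q"
    and w: "w = (inverse a * (deriv g1 r / (2 * r))) *\<^sub>R p + (deriv g2 r / (2 * r)) *\<^sub>R q"
    by (auto simp: Amap_def)
  have comb: "norm (k *\<^sub>R p + l *\<^sub>R q) \<le> k' + l'" if "\<bar>k\<bar> \<le> k'" "\<bar>l\<bar> \<le> l'" for k l k' l'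
  proof -
    have "norm (k *\<^sub>R p + l *\<^sub>R q) \<le> \<bar>k\<bar> * norm p + \<bar>l\<bar> * norm q"
      by (metis norm_scaleR norm_triangle_ineq)
    also have "\<dots> \<le> k' * 1 + l' * 1"
      using that \<open>norm p \<le> 1\<close> \<open>norm q \<le> 1\<close> by (intro add_mono mult_mono) auto
    finally show ?thesis by simp
  qed
  note entries = abs_matrix_entries_le [OF assms(1)]
  have "\<bar>a * g2 r\<bar> \<le> 2 * r ^ 3"
    unfolding abs_mult using a entries by (intro mult_mono) auto
  from comb [OF entries(1) this] have "norm y \<le> 3 * r ^ 3"
    by (simp add: y)
  moreover from comb [OF abs_lower_left_entry_le [OF a assms(1)] entries(4)] have "norm w \<le> 4 * r"
    by (simp add: w)
  ultimately show ?thesis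
    using s by (auto simp: kinetic_box_def fields)
qed

lemma kinetic_box_measurable: "kinetic_box r \<in> sets borel"
  unfolding kinetic_box_def by (intro borel_closed closed_Times) auto

lemma emeasure_lborel_Times:
  fixes A :: "'a::euclidean_space set" and B :: "'b::euclidean_space set"
  assumes "A \<in> sets borel" "B \<in> sets borel"
  shows "emeasure lborel (A \<times> B) = emeasure lborel A * emeasure lborel B"
  using lborel.emeasure_pair_measure_Times [of A lborel B] assms by (simp add: lborel_prod)

lemma emeasure_kinetic_box:
  assumes "r > 0"
  shows "emeasure lborel (kinetic_box r :: 'd::finite point set) =
    ennreal (12 ^ CARD('d) * (unit_ball_vol (real CARD('d)))\<^sup>2 * r powr real (hom_dim CARD('d)))"
proof -
  let ?d = "CARD('d)" and ?V = "unit_ball_vol (real CARD('d))"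
  have "emeasure lborel (kinetic_box r :: 'd point set) =
      emeasure lborel {- 2 * r\<^sup>2 .. - r\<^sup>2} *
      (emeasure lborel (cball (0 :: real ^ 'd) (3 * r ^ 3)) * emeasure lborel (cball (0 :: real ^ 'd) (4 * r)))"
    unfolding kinetic_box_def by (simp add: emeasure_lborel_Times borel_Times)
  also have "\<dots> = ennreal (r\<^sup>2 * ((?V * (3 * r ^ 3) ^ ?d) * (?V * (4 * r) ^ ?d)))"
    using assms by (simp add: emeasure_cball ennreal_mult)
  also have "r\<^sup>2 * ((?V * (3 * r ^ 3) ^ ?d) * (?V * (4 * r) ^ ?d))
      = (3 * 4) ^ ?d * ?V\<^sup>2 * (r\<^sup>2 * (r ^ 3) ^ ?d * r ^ ?d)"
    unfolding power_mult_distrib by (simp add: power2_eq_square)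
  also have "r\<^sup>2 * (r ^ 3) ^ ?d * r ^ ?d = r ^ hom_dim ?d"
    unfolding hom_dim_def by (simp flip: power_mult power_add)
  also have "\<dots> = r powr real (hom_dim ?d)"
    using assms by (simp add: powr_realpow)
  finally show ?thesis by simp
qed

lemma emeasure_lborel_translate:
  fixes S :: "'a::euclidean_space set"
  assumes "S \<in> sets borel"
  shows "emeasure lborel ((\<lambda>x. x + v) -` S) = emeasure lborel S"
proof -
  have "emeasure lborel S = emeasure (distr lborel borel ((+) v)) S"
    by (simp add: lborel_distr_plus)
  also have "\<dots> = emeasure lborel ((+) v -` S)"
    using assms by (subst emeasure_distr) auto
  also have "(+) v = (\<lambda>x. x + v)"
    by (auto simp: add.commute)
  finally show ?thesis
    by (rule sym)
qed

section \<open>Measurability\<close>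

lemma point_coordinates_measurable [measurable]:
  "(\<lambda>x :: 'd::finite point. fst x) \<in> borel_measurable borel"
  "(\<lambda>x :: 'd point. fst (snd x)) \<in> borel_measurable borel"
  "(\<lambda>x :: 'd point. snd (snd x)) \<in> borel_measurable borel"
  by (intro borel_measurable_continuous_onI continuous_intros)+

lemma kernel_amp_measurable [measurable]: "kernel_amp d r \<in> borel_measurable borel"
  unfolding kernel_amp_def [abs_def] by measurable

lemma kernel_arg_measurable [measurable]:
  "kernel_arg r \<in> borel_measurable (borel :: 'd::finite point measure)"
  unfolding kernel_arg_def case_prod_beta
  by (intro borel_measurable_Pair borel_measurable_scaleR borel_measurable_diff borel_measurable_times
      borel_measurable_inverse borel_measurable_divide borel_measurable_const
      point_coordinates_measurable)

lemma kin_kernel_measurable: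
  fixes \<psi> :: "'d::finite point \<Rightarrow> real"
  assumes "r > 0" "continuous_on UNIV \<psi>"
  shows "kin_kernel \<psi> r \<in> borel_measurable borel"
proof -
  have [measurable]: "\<psi> \<in> borel_measurable borel"
    using assms(2) by (rule borel_measurable_continuous_onI)
  show ?thesis
    unfolding kin_kernel_eq [OF assms(1), abs_def] by measurable
qed

section \<open>The gradient of the kernel in the spatial variable\<close>

text \<open>The chain rule: \<open>y\<close> enters both vector components of the argument of \<open>\<psi>\<close>, with the
  coefficients of the first column of the inverse matrix.\<close>
definition kernel_grad :: "('d::finite point \<Rightarrow> real) \<Rightarrow> real \<Rightarrow> 'd point \<Rightarrow> real ^ 'd" where
  "kernel_grad \<psi> r x = kernel_amp CARD('d) r (fst x) *\<^sub>R
     ((- 2 / r ^ 4 * (deriv g2 r / (2 * r))) *\<^sub>R pull_grad (\<lambda>v. (0, v, 0)) \<psi> (kernel_arg r x) +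
      (2 / r ^ 4 * (inverse (fst x / r\<^sup>2) * (deriv g1 r / (2 * r)))) *\<^sub>R
        pull_grad (\<lambda>v. (0, 0, v)) \<psi> (kernel_arg r x))"

lemma GDERIV_kin_kernel:
  fixes \<psi> :: "'d::finite point \<Rightarrow> real"
  assumes "r > 0" "smooth \<psi>"
  shows "GDERIV (\<lambda>y. kin_kernel \<psi> r (s, y, w)) y :> kernel_grad \<psi> r (s, y, w)"
proof -
  define A where "A = kernel_amp CARD('d) r s"
  define k where "k = - 2 / r ^ 4 * (deriv g2 r / (2 * r))"
  define l where "l = 2 / r ^ 4 * (inverse (s / r\<^sup>2) * (deriv g1 r / (2 * r)))"
  let ?m = "kernel_arg r (s, y, w)"
  let ?D = "frechet_derivative \<psi> (at ?m)"
  have arg: "((\<lambda>y. kernel_arg r (s, y, w)) has_derivative (\<lambda>v. (0, k *\<^sub>R v, l *\<^sub>R v))) (at y)"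
    unfolding kernel_arg_def
    by (auto intro!: derivative_eq_intros simp: k_def l_def)
  have lin: "linear ?D"
    using smooth_has_derivative [OF assms(2)] has_derivative_linear by blast
  have D: "?D (0, k *\<^sub>R v, l *\<^sub>R v) =
      v \<bullet> (k *\<^sub>R pull_grad (\<lambda>v. (0, v, 0)) \<psi> ?m + l *\<^sub>R pull_grad (\<lambda>v. (0, 0, v)) \<psi> ?m)" for v
  proof -
    have lin_incl: "linear (\<lambda>v::real^'d. (0::real, v, 0::real^'d))" "linear (\<lambda>v::real^'d. (0::real, 0::real^'d, v))"
      by (auto intro!: linearI)
    have "(0, k *\<^sub>R v, l *\<^sub>R v) = k *\<^sub>R (0::real, v, 0) + l *\<^sub>R (0, 0, v)"
      by simp
    then have "?D (0, k *\<^sub>R v, l *\<^sub>R v) = k * ?D (0, v, 0) + l * ?D (0, 0, v)"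
      by (simp only: linear_add [OF lin] linear_cmul [OF lin] real_scaleR_def)
    then show ?thesis
      using frechet_derivative_eq_inner_pull_grad [OF assms(2) lin_incl(1), of ?m v]
        frechet_derivative_eq_inner_pull_grad [OF assms(2) lin_incl(2), of ?m v]
      by (simp add: inner_add_right)
  qed
  have "((\<lambda>y. A * \<psi> (kernel_arg r (s, y, w))) has_derivative (\<lambda>v. A * ?D (0, k *\<^sub>R v, l *\<^sub>R v))) (at y)"
    using has_derivative_compose [OF arg smooth_has_derivative [OF assms(2)]]
    by (rule has_derivative_mult_right)
  then show ?thesis
    unfolding gderiv_def kin_kernel_eq [OF assms(1)] kernel_grad_def D
    by (simp add: A_def k_def l_def)
qed

lemma grad_y_kin_kernel:
  assumes "r > 0" "smooth \<psi>"
  shows "grad_y (kin_kernel \<psi> r) = kernel_grad \<psi> r"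
proof -
  have unique: "D = D'" if "GDERIV f y :> D" "GDERIV f y :> D'" for f and y D D' :: "real ^ 'd"
    using has_derivative_unique that unfolding gderiv_def
    by (metis (mono_tags, lifting) vector_eq_rdot inner_commute)
  show ?thesis
    unfolding grad_y_def
    by (auto simp: fun_eq_iff intro!: the_equality GDERIV_kin_kernel [OF assms] intro: unique)
qed

lemma kernel_grad_measurable:
  assumes "smooth \<psi>"
  shows "kernel_grad \<psi> r \<in> borel_measurable borel"
proof -
  have [measurable]: "pull_grad \<iota> \<psi> \<in> borel_measurable borel" for \<iota> :: "real ^ 'a \<Rightarrow> _"
    using continuous_on_pull_grad [OF assms] by (rule borel_measurable_continuous_onI)
  show ?thesis
    unfolding kernel_grad_def [abs_def] by measurable
qed

text \<open>Both entries in play are at most \<open>2 r\<close>, so a derivative in \<open>y\<close> costs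
  \<open>(2 / r\<^sup>4) (2 r + 2 r) = 8 r\<^bsup>-3\<^esup>\<close>.\<close>
lemma norm_kernel_grad_le:
  fixes \<psi> :: "'d::finite point \<Rightarrow> real"
  assumes "r > 0" "M \<ge> 0"
    and "\<And>m. norm (pull_grad (\<lambda>v::real^'d. (0, v, 0)) \<psi> m) \<le> M"
    and "\<And>m. norm (pull_grad (\<lambda>v::real^'d. (0, 0, v)) \<psi> m) \<le> M"
  shows "norm (kernel_grad \<psi> r x) \<le> 2 ^ (CARD('d) + 2) * 8 * M * r powr (- 2 - real (hom_dim CARD('d)))"
proof (cases "kernel_amp CARD('d) r (fst x) = 0")
  case True
  then show ?thesis
    using assms by (simp add: kernel_grad_def)
next
  case False
  let ?Q = "real (hom_dim CARD('d))"
  define a where "a = fst x / r\<^sup>2"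
  define P where "P = pull_grad (\<lambda>v::real^'d. (0, v, 0)) \<psi> (kernel_arg r x)"
  define R where "R = pull_grad (\<lambda>v::real^'d. (0, 0, v)) \<psi> (kernel_arg r x)"
  define k l where "k = deriv g2 r / (2 * r)" and "l = inverse a * (deriv g1 r / (2 * r))"
  have a: "a \<in> {-2<..<-1}"
    using kernel_amp_nonzero(1) [OF False assms(1)] by (simp add: a_def)
  note entries = abs_matrix_entries_le [OF assms(1)]
  have "\<bar>l\<bar> \<le> 2 * r"
    unfolding l_def by (rule abs_lower_left_entry_le [OF a assms(1)])
  moreover have "\<bar>k\<bar> \<le> 2 * r"
    using entries by (simp add: k_def)
  moreover have "norm P \<le> M" "norm R \<le> M"
    using assms by (simp_all add: P_def R_def)
  ultimately have sum: "\<bar>k\<bar> * norm P + \<bar>l\<bar> * norm R \<le> 2 * r * M + 2 * r * M"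
    using assms by (intro add_mono mult_mono) auto
  have "norm ((- 2 / r ^ 4 * k) *\<^sub>R P + (2 / r ^ 4 * l) *\<^sub>R R)
      \<le> norm ((- 2 / r ^ 4 * k) *\<^sub>R P) + norm ((2 / r ^ 4 * l) *\<^sub>R R)"
    by (rule norm_triangle_ineq)
  also have "\<dots> = 2 / r ^ 4 * (\<bar>k\<bar> * norm P + \<bar>l\<bar> * norm R)"
    using assms(1) by (simp add: abs_mult algebra_simps)
  also have "\<dots> \<le> 2 / r ^ 4 * (2 * r * M + 2 * r * M)"
    using sum assms(1) by (intro mult_left_mono) auto
  also have "\<dots> = 8 * M * r powr (- 3)"
    using assms(1) by (simp add: powr_minus powr_numeral field_simps power_numeral_reduce)
  finally have inner_bound: "norm ((- 2 / r ^ 4 * k) *\<^sub>R P + (2 / r ^ 4 * l) *\<^sub>R R) \<le> 8 * M * r powr (- 3)" .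
  have "norm (kernel_grad \<psi> r x) =
      \<bar>kernel_amp CARD('d) r (fst x)\<bar> * norm ((- 2 / r ^ 4 * k) *\<^sub>R P + (2 / r ^ 4 * l) *\<^sub>R R)"
    by (simp add: kernel_grad_def P_def R_def k_def l_def a_def)
  also have "\<dots> \<le> 2 ^ (CARD('d) + 2) * r powr (1 - ?Q) * (8 * M * r powr (- 3))"
    using inner_bound abs_kernel_amp_le [OF assms(1)] by (intro mult_mono) auto
  also have "\<dots> = 2 ^ (CARD('d) + 2) * 8 * M * (r powr (1 - ?Q) * r powr (- 3))"
    by simp
  also have "r powr (1 - ?Q) * r powr (- 3) = r powr (- 2 - ?Q)"
    by (simp flip: powr_add)
  finally show ?thesis .
qed

lemma GDERIV_lipschitz:
  fixes f :: "'a::real_inner \<Rightarrow> real"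
  assumes "\<And>y. GDERIV f y :> G y" "\<And>y. norm (G y) \<le> B"
  shows "\<bar>f x - f y\<bar> \<le> B * norm (x - y)"
proof -
  have "onorm (\<lambda>v. v \<bullet> G z) \<le> B" for z
  proof (rule onorm_bound)
    show "0 \<le> B"
      using assms(2) [of z] norm_ge_zero order.trans by blast
    show "norm (v \<bullet> G z) \<le> B * norm v" for v
      using Cauchy_Schwarz_ineq2 [of v "G z"] mult_left_mono [OF assms(2) [of z], of "norm v"]
      by (simp add: mult.commute)
  qed
  then have "norm (f x - f y) \<le> B * norm (x - y)"
    using assms(1) by (intro differentiable_bound [of UNIV f "\<lambda>z v. v \<bullet> G z"])
      (auto simp: gderiv_def)
  then show ?thesis
    by simp
qed

section \<open>The estimates\<close>

theorem corollary2p5: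
  fixes \<psi> :: "'d::finite point \<Rightarrow> real"
  assumes "Cc_infty \<psi>"
    and "\<And>m. \<psi> m \<ge> 0"
    and "(LINT m|lborel. \<psi> m) = 1"
    and "supp \<psi> \<subseteq> {-2<..<-1} \<times> ball 0 1 \<times> ball 0 1"
  shows "\<exists>C::real. C > 0 \<and>
    (\<forall>\<theta> \<theta>' :: ennreal. 1 \<le> \<theta> \<longrightarrow> 1 / \<theta> + 1 / \<theta>' = 1 \<longrightarrow>
      (\<forall>r::real. \<forall>h :: real ^ 'd. r > 0 \<longrightarrow>
        (let Q = real (hom_dim CARD('d)); K = kin_kernel \<psi> r in
          Lnorm \<theta> K \<le> ennreal (C * r powr (1 - Q * enn2real (1 / \<theta>'))) \<and>
          Lnorm \<theta> (grad_y K) \<le> ennreal (C * r powr (- 2 - Q * enn2real (1 / \<theta>'))) \<and>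
          Lnorm \<theta> (diff_x h K) \<le>
            ennreal (C * r powr (1 - Q * enn2real (1 / \<theta>')) * min 1 (norm h * r powr (- 3))))))"
proof -
  let ?incl1 = "\<lambda>v::real^'d. (0::real, v, 0::real^'d)"
  let ?incl2 = "\<lambda>v::real^'d. (0::real, 0::real^'d, v)"
  define Q where "Q = real (hom_dim CARD('d))"
  have smooth: "smooth \<psi>" and comp: "compact (supp \<psi>)"
    using assms(1) by (auto simp: Cc_infty_def)
  obtain M0 where M0: "M0 \<ge> 0" "\<And>m. norm (\<psi> m) \<le> M0"
    using bounded_of_compact_support [OF smooth_continuous_on [OF smooth] comp] not_in_supp [of _ \<psi>]
    by metis
  obtain M1 where M1: "M1 \<ge> 0" "\<And>m. norm (pull_grad ?incl1 \<psi> m) \<le> M1"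
    using bounded_of_compact_support [OF continuous_on_pull_grad [OF smooth] comp]
      pull_grad_not_in_supp [of _ \<psi>] by metis
  obtain M2 where M2: "M2 \<ge> 0" "\<And>m. norm (pull_grad ?incl2 \<psi> m) \<le> M2"
    using bounded_of_compact_support [OF continuous_on_pull_grad [OF smooth] comp]
      pull_grad_not_in_supp [of _ \<psi>] by metis
  define M where "M = max M1 M2"
  have M: "M \<ge> 0" "norm (pull_grad ?incl1 \<psi> m) \<le> M" "norm (pull_grad ?incl2 \<psi> m) \<le> M" for m
    using M1 M2 by (auto simp: M_def le_max_iff_disj)
  define N :: real where "N = 1 + 2 ^ (CARD('d) + 2) * (2 * M0 + 8 * M)"
  define c0 where "c0 = 12 ^ CARD('d) * (unit_ball_vol (real CARD('d)))\<^sup>2"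
  \<comment> \<open>The factor 2 pays for the two translates of the box that carry the increment.\<close>
  define c where "c = max 1 (2 * c0)"
  have N: "N \<ge> 1"
    using M0 M by (simp add: N_def)
  have c: "c \<ge> 1" "2 * c0 \<le> c" "c0 \<ge> 0"
    by (auto simp: c_def c0_def)
  have main: "Lnorm \<theta> (kin_kernel \<psi> r) \<le> ennreal (N * c * r powr (1 - Q * enn2real (1 / \<theta>')))"
      "Lnorm \<theta> (grad_y (kin_kernel \<psi> r)) \<le> ennreal (N * c * r powr (- 2 - Q * enn2real (1 / \<theta>')))"
      "Lnorm \<theta> (diff_x h (kin_kernel \<psi> r)) \<le>
        ennreal (N * c * r powr (1 - Q * enn2real (1 / \<theta>')) * min 1 (norm h * r powr (- 3)))"
    if \<theta>: "1 \<le> \<theta>" "1 / \<theta> + 1 / \<theta>' = 1" and r: "r > 0" for \<theta> \<theta>' r and h :: "real ^ 'd"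
  proof -
    let ?K = "kin_kernel \<psi> r"
    let ?S = "kinetic_box r :: 'd point set"
    define \<mu> where "\<mu> = min 1 (norm h * r powr (- 3))"
    have \<mu>: "\<mu> \<ge> 0"
      by (simp add: \<mu>_def)
    have vol: "emeasure lborel ?S = ennreal (c0 * r powr Q)"
      by (simp add: emeasure_kinetic_box [OF r] c0_def Q_def)
    also have "\<dots> \<le> ennreal (c * r powr Q)"
      using c by (intro ennreal_leI mult_right_mono) auto
    finally have S: "emeasure lborel ?S \<le> ennreal (c * r powr Q)" .
    have in_S: "x \<in> ?S" if "kernel_amp CARD('d) r (fst x) \<noteq> 0" "kernel_arg r x \<in> supp \<psi>" for x :: "'d point"
      using in_kinetic_boxI [OF r that(1)] that(2) assms(4) by blast
    have off_S: "kernel_amp CARD('d) r (fst x) = 0 \<or> kernel_arg r x \<notin> supp \<psi>" if "x \<notin> ?S" for x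
      using in_S that by blast
    have K0: "?K x = 0" if "x \<notin> ?S" for x
      using off_S [OF that] by (auto simp: kin_kernel_eq [OF r] not_in_supp)
    have G0: "kernel_grad \<psi> r x = 0" if "x \<notin> ?S" for x
      using off_S [OF that] by (elim disjE) (simp_all add: kernel_grad_def pull_grad_not_in_supp)
    have K: "\<bar>?K x\<bar> \<le> 2 ^ (CARD('d) + 2) * M0 * r powr (1 - Q)" for x
    proof -
      have "\<bar>?K x\<bar> \<le> 2 ^ (CARD('d) + 2) * r powr (1 - Q) * M0"
        unfolding kin_kernel_eq [OF r] abs_mult Q_def
        using M0(2) abs_kernel_amp_le [OF r] by (intro mult_mono) auto
      then show ?thesis by (simp add: ac_simps)
    qed
    have G: "norm (kernel_grad \<psi> r x) \<le> 2 ^ (CARD('d) + 2) * 8 * M * r powr (- 2 - Q)" for x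
      unfolding Q_def by (rule norm_kernel_grad_le [OF r M])
    have meas: "?K \<in> borel_measurable borel"
      by (rule kin_kernel_measurable [OF r smooth_continuous_on [OF smooth]])
    have K': "\<bar>?K x\<bar> \<le> N * r powr (1 - Q)" for x
      by (rule order.trans [OF K], intro mult_right_mono) (use M0 M in \<open>simp_all add: N_def algebra_simps\<close>)
    have "Lnorm \<theta> ?K \<le> ennreal (N * r powr (1 - Q) * c * r powr (Q - Q * enn2real (1 / \<theta>')))"
      using K' N
      by (intro Lnorm_le_of_bounded_support [OF meas kinetic_box_measurable S _ K0 c(1) _ r \<theta>]) auto
    also have "N * r powr (1 - Q) * c * r powr (Q - Q * enn2real (1 / \<theta>'))
        = N * c * (r powr (1 - Q) * r powr (Q - Q * enn2real (1 / \<theta>')))"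
      by simp
    also have "\<dots> = N * c * r powr (1 - Q * enn2real (1 / \<theta>'))"
      unfolding powr_add [symmetric] by simp
    finally show "Lnorm \<theta> ?K \<le> ennreal (N * c * r powr (1 - Q * enn2real (1 / \<theta>')))" .
    have G': "norm (kernel_grad \<psi> r x) \<le> N * r powr (- 2 - Q)" for x
      by (rule order.trans [OF G], intro mult_right_mono) (use M0 M in \<open>simp_all add: N_def algebra_simps\<close>)
    have "Lnorm \<theta> (kernel_grad \<psi> r)
        \<le> ennreal (N * r powr (- 2 - Q) * c * r powr (Q - Q * enn2real (1 / \<theta>')))"
      using N
      by (intro Lnorm_le_of_bounded_support
          [OF kernel_grad_measurable [OF smooth] kinetic_box_measurable S G' G0 c(1) _ r \<theta>]) auto
    also have "N * r powr (- 2 - Q) * c * r powr (Q - Q * enn2real (1 / \<theta>'))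
        = N * c * (r powr (- 2 - Q) * r powr (Q - Q * enn2real (1 / \<theta>')))"
      by simp
    also have "\<dots> = N * c * r powr (- 2 - Q * enn2real (1 / \<theta>'))"
      unfolding powr_add [symmetric] by simp
    finally show "Lnorm \<theta> (grad_y ?K) \<le> ennreal (N * c * r powr (- 2 - Q * enn2real (1 / \<theta>')))"
      unfolding grad_y_kin_kernel [OF r smooth] .
    define T where "T = (\<lambda>x. x + (0, h, 0)) -` ?S"
    have diff_eq: "diff_x h ?K x = ?K (x + (0, h, 0)) - ?K x" for x
      by (cases x) (simp add: diff_x_def)
    have shift: "(\<lambda>x :: 'd point. x + (0, h, 0)) \<in> borel_measurable borel"
      by (intro borel_measurable_continuous_onI continuous_intros)
    have T: "T \<in> sets borel"
      using measurable_sets [OF shift kinetic_box_measurable] by (simp add: T_def)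
    have diff_meas: "diff_x h ?K \<in> borel_measurable borel"
      unfolding diff_eq [abs_def] by (intro borel_measurable_diff meas measurable_compose [OF shift meas])
    have "emeasure lborel (?S \<union> T) \<le> emeasure lborel ?S + emeasure lborel T"
      using T kinetic_box_measurable by (intro emeasure_subadditive) auto
    also have "\<dots> = ennreal (2 * c0 * r powr Q)"
      using c(3) unfolding T_def emeasure_lborel_translate [OF kinetic_box_measurable] vol
      by (simp flip: ennreal_plus)
    also have "\<dots> \<le> ennreal (c * r powr Q)"
      using c by (intro ennreal_leI mult_right_mono) auto
    finally have U: "emeasure lborel (?S \<union> T) \<le> ennreal (c * r powr Q)" .
    have U0: "diff_x h ?K x = 0" if "x \<notin> ?S \<union> T" for x
      using that K0 by (simp add: diff_eq T_def)
    have bound: "norm (diff_x h ?K x) \<le> N * r powr (1 - Q) * \<mu>" for x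
    proof (cases x)
      case (fields s y w)
      have "\<bar>diff_x h ?K x\<bar> \<le> \<bar>?K (x + (0, h, 0))\<bar> + \<bar>?K x\<bar>"
        unfolding diff_eq by (rule abs_triangle_ineq4)
      also have "\<dots> \<le> 2 ^ (CARD('d) + 2) * M0 * r powr (1 - Q) + 2 ^ (CARD('d) + 2) * M0 * r powr (1 - Q)"
        by (intro add_mono K)
      also have "\<dots> = 2 ^ (CARD('d) + 2) * (2 * M0) * r powr (1 - Q)"
        by simp
      also have "\<dots> \<le> N * r powr (1 - Q)"
        using M0 M by (intro mult_right_mono) (simp_all add: N_def algebra_simps)
      finally have 1: "\<bar>diff_x h ?K x\<bar> \<le> N * r powr (1 - Q)" .
      have "\<bar>?K (s, y + h, w) - ?K (s, y, w)\<bar> \<le> N * r powr (- 2 - Q) * norm (y + h - y)"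
        by (rule GDERIV_lipschitz [where f = "\<lambda>y. ?K (s, y, w)", OF GDERIV_kin_kernel [OF r smooth] G'])
      also have "r powr (- 2 - Q) = r powr (1 - Q) * r powr (- 3)"
        by (simp flip: powr_add)
      finally have 2: "\<bar>diff_x h ?K x\<bar> \<le> N * r powr (1 - Q) * (norm h * r powr (- 3))"
        by (simp add: fields diff_x_def ac_simps)
      show ?thesis
        using 1 2 by (simp add: \<mu>_def min_def)
    qed
    have "Lnorm \<theta> (diff_x h ?K)
        \<le> ennreal (N * r powr (1 - Q) * \<mu> * c * r powr (Q - Q * enn2real (1 / \<theta>')))"
      using T kinetic_box_measurable N \<mu>
      by (intro Lnorm_le_of_bounded_support [OF diff_meas _ U bound U0 c(1) _ r \<theta>]) auto
    also have "N * r powr (1 - Q) * \<mu> * c * r powr (Q - Q * enn2real (1 / \<theta>'))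
        = N * c * (r powr (1 - Q) * r powr (Q - Q * enn2real (1 / \<theta>'))) * \<mu>"
      by simp
    also have "\<dots> = N * c * r powr (1 - Q * enn2real (1 / \<theta>')) * \<mu>"
      unfolding powr_add [symmetric] by simp
    finally show "Lnorm \<theta> (diff_x h ?K) \<le>
        ennreal (N * c * r powr (1 - Q * enn2real (1 / \<theta>')) * min 1 (norm h * r powr (- 3)))"
      unfolding \<mu>_def .
  qed
  have "N * c > 0"
    using N c by simp
  with main show ?thesis
    unfolding Let_def Q_def by blast
qed

end
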